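(* For each integer $r\ge 2$, let $W_r$ be a random variable whose distribution function is $$F_r(t)=\prod_{p}\mathbb{P}\big(\mathrm{Bin}(r,1/p)\le t\big),\qquad t\in\mathbb{R},$$ where the product runs over all primes $p$ and $\mathrm{Bin}(r,q)$ denotes a binomial random variable with $r$ trials and success probability $q$. There are absolute constants $A,B>0$ such that for every integer $r\ge 2$ and every $t\in\mathbb{R}$, $$0\le \mathbb{P}\big(\mathrm{Bin}(r,1/2)\le t\big)-\mathbb{P}\big(W_r\le t\big)\le A e^{-Br}.$$
   Context: The variable $W_r$ takes values in $\{0,1,\dots,r\}$ and informally represents the index of codivisibility of a random $r$-tuple of positive integers, i.e. the maximum over primes $p$ of the number of entries divisible by $p$. *)

theory Defs
  imports "HOL-Probability.Probability" "HOL-Computational_Algebra.Primes"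
begin

definition binomial_cdf :: "nat \<Rightarrow> real \<Rightarrow> real \<Rightarrow> real" where
  "binomial_cdf r q t = measure_pmf.prob (binomial_pmf r q) {k. real k \<le> t}"

text \<open>
  The product over all primes is taken as the limit of the products over the primes up to \<open>n\<close>.
  For \<open>t < 1\<close> and \<open>r > 0\<close> its value is \<open>0\<close>, as a product that diverges to \<open>0\<close> (\<open>0 \<le> t < 1\<close>)
  or has only vanishing factors (\<open>t < 0\<close>); the constant \<^const>\<open>prodinf\<close> is unspecified in
  these cases, since \<^const>\<open>has_prod\<close> then fails.
\<close>

definition codivisibility_cdf :: "nat \<Rightarrow> real \<Rightarrow> real" where
  "codivisibility_cdf r t =
     lim (\<lambda>n. \<Prod>p\<in>{p::nat. prime p \<and> p \<le> n}. binomial_cdf r (1 / real p) t)"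

text \<open>
  The law of \<open>W\<^sub>r\<close>: a Borel probability measure on the reals with the prescribed
  distribution function. Using the law rather than a random variable on some sample space keeps
  constants that must not depend on \<open>W\<^sub>r\<close> independent of the type of the sample space.
\<close>

definition codivisibility_law :: "nat \<Rightarrow> real measure \<Rightarrow> bool" where
  "codivisibility_law r \<mu> \<longleftrightarrow> real_distribution \<mu> \<and> (\<forall>t. cdf \<mu> t = codivisibility_cdf r t)"

lemma codivisibility_law_distr:
  assumes "prob_space M" "W \<in> borel_measurable M"
    and "\<And>t. measure M {x \<in> space M. W x \<le> t} = codivisibility_cdf r t"
  shows "codivisibility_law r (distr M borel W)"
proof -
  interpret prob_space M by fact
  have "cdf (distr M borel W) t = codivisibility_cdf r t" for t
  proof -
    have "W -` {..t} \<inter> space M = {x \<in> space M. W x \<le> t}" by auto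
    then show ?thesis
      using assms(2,3) by (simp add: cdf_def measure_distr)
  qed
  then show ?thesis
    using assms(2) by (simp add: codivisibility_law_def real_distribution_distr)
qed

lemma binomial_cdf_nonneg: "0 \<le> binomial_cdf r q t"
  and binomial_cdf_le_1: "binomial_cdf r q t \<le> 1"
  by (simp_all add: binomial_cdf_def)

lemma binomial_cdf_mono: "s \<le> t \<Longrightarrow> binomial_cdf r q s \<le> binomial_cdf r q t"
  unfolding binomial_cdf_def by (intro measure_pmf.finite_measure_mono) auto

lemma finite_primes_le: "finite {p::nat. prime p \<and> p \<le> n}"
  by (rule finite_subset[of _ "{..n}"]) auto

lemma prod_binomial_cdf_tendsto:
  "(\<lambda>n. \<Prod>p\<in>{p::nat. prime p \<and> p \<le> n}. binomial_cdf r (1 / real p) t)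
     \<longlonglongrightarrow> codivisibility_cdf r t"
proof -
  let ?P = "\<lambda>n. \<Prod>p\<in>{p::nat. prime p \<and> p \<le> n}. binomial_cdf r (1 / real p) t"
  have "?P n \<le> ?P m" if "m \<le> n" for m n
  proof -
    have "?P n = ?P m * (\<Prod>p\<in>{p::nat. prime p \<and> p \<le> n} - {p. prime p \<and> p \<le> m}.
        binomial_cdf r (1 / real p) t)"
      using that by (subst prod.subset_diff[of "{p. prime p \<and> p \<le> m}"])
        (auto simp: finite_primes_le mult.commute)
    also have "\<dots> \<le> ?P m * 1"
      by (intro mult_left_mono prod_le_1 prod_nonneg)
        (auto simp: binomial_cdf_nonneg binomial_cdf_le_1)
    finally show ?thesis by simp
  qed
  then have "decseq ?P" by (auto simp: decseq_def)
  moreover have "0 \<le> ?P n" for n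
    by (intro prod_nonneg ballI binomial_cdf_nonneg)
  ultimately have "convergent ?P"
    using decseq_convergent[of ?P 0] by (metis convergentI)
  then show ?thesis
    by (simp add: codivisibility_cdf_def convergent_LIMSEQ_iff)
qed

lemma codivisibility_cdf_mono:
  "s \<le> t \<Longrightarrow> codivisibility_cdf r s \<le> codivisibility_cdf r t"
  by (rule LIMSEQ_le[OF prod_binomial_cdf_tendsto prod_binomial_cdf_tendsto])
    (auto intro!: exI prod_mono simp: binomial_cdf_nonneg binomial_cdf_mono)

lemma codivisibility_cdf_neg:
  assumes "t < 0" shows "codivisibility_cdf r t = 0"
proof -
  have "{k. real k \<le> t} = {}" using assms by auto
  then have *: "binomial_cdf r q t = 0" for q by (simp add: binomial_cdf_def)
  have "\<forall>\<^sub>F n in sequentially.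
      (\<Prod>p\<in>{p::nat. prime p \<and> p \<le> n}. binomial_cdf r (1 / real p) t) = 0"
    using eventually_ge_at_top[of 2]
  proof eventually_elim
    case (elim n)
    then show ?case
      by (intro prod_zero finite_primes_le bexI[of _ 2]) (auto simp: *)
  qed
  then show ?thesis
    using LIMSEQ_unique[OF prod_binomial_cdf_tendsto tendsto_eventually] by blast
qed

lemma codivisibility_cdf_ge:
  assumes "real r \<le> t" shows "codivisibility_cdf r t = 1"
proof -
  have "binomial_cdf r (1 / real p) t = 1" if "prime p" for p
  proof -
    have "set_pmf (binomial_pmf r (1 / real p)) \<subseteq> {..r}"
      using prime_gt_1_nat[OF that] by (subst set_pmf_binomial) auto
    also have "\<dots> \<subseteq> {k. real k \<le> t}" using assms by auto
    finally show ?thesis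
      unfolding binomial_cdf_def by (auto simp: measure_pmf.prob_eq_1 AE_measure_pmf_iff)
  qed
  then have "(\<lambda>n. \<Prod>p\<in>{p::nat. prime p \<and> p \<le> n}. binomial_cdf r (1 / real p) t) = (\<lambda>n. 1)"
    by simp
  then show ?thesis
    using LIMSEQ_unique[OF prod_binomial_cdf_tendsto[of r t]] by auto
qed

lemma codivisibility_cdf_right_cont: "continuous (at_right a) (codivisibility_cdf r)"
proof -
  have "\<forall>\<^sub>F x in at_right a. codivisibility_cdf r x = codivisibility_cdf r a"
    unfolding eventually_at_right_field
  proof (intro exI conjI allI impI)
    show "a < of_int \<lfloor>a\<rfloor> + 1" by linarith
    fix x assume x: "a < x" "x < of_int \<lfloor>a\<rfloor> + 1"
    have "real k \<le> x \<longleftrightarrow> real k \<le> a" for k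
    proof
      assume "real k \<le> x"
      with x have "real_of_int (int k) < of_int (\<lfloor>a\<rfloor> + 1)" by simp
      then have "int k \<le> \<lfloor>a\<rfloor>" by linarith
      then show "real k \<le> a" by linarith
    qed (use x in simp)
    then show "codivisibility_cdf r x = codivisibility_cdf r a"
      by (simp add: codivisibility_cdf_def binomial_cdf_def)
  qed
  then show ?thesis
    unfolding continuous_within by (rule tendsto_eventually)
qed

lemma codivisibility_law_exists: "codivisibility_law r (interval_measure (codivisibility_cdf r))"
proof -
  have bot: "(codivisibility_cdf r \<longlongrightarrow> 0) at_bot"
    by (intro tendsto_eventually eventually_mono[OF eventually_le_at_bot[of "-1"]]
        codivisibility_cdf_neg) simp
  have top: "(codivisibility_cdf r \<longlongrightarrow> 1) at_top"
    by (intro tendsto_eventually eventually_mono[OF eventually_ge_at_top[of "real r"]]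
        codivisibility_cdf_ge)
  show ?thesis
    unfolding codivisibility_law_def cdf_def
    using real_distribution_interval_measure[OF codivisibility_cdf_mono
        codivisibility_cdf_right_cont bot top]
      measure_interval_measure_Iic[OF codivisibility_cdf_mono codivisibility_cdf_right_cont bot]
    by blast
qed

end

theory Submission
  imports Defs
begin

text \<open>
  With \<open>G\<close> the distribution function of \<open>Bin(r, 1/2)\<close>, the difference is
  \<open>G(t) (1 - \<Prod>\<^sub>p\<^sub>\<ge>\<^sub>3 P(Bin(r, 1/p) \<le> t))\<close>. The threshold \<open>2r/5\<close> lies strictly between the means
  \<open>r/3\<close> and \<open>r/2\<close>. Below it, \<open>G(t)\<close> is itself exponentially small; above it, the second factor is
  at most \<open>\<Sum>\<^sub>p\<^sub>\<ge>\<^sub>3 P(Bin(r, 1/p) > 2r/5)\<close>. An exponential Markov bound with \<open>x\<^sup>k\<close>, where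
  \<open>x = p/2\<close>, makes the \<open>p\<close>-th summand at most \<open>g\<^sub>p\<close> to the power \<open>r/5\<close> with
  \<open>g\<^sub>p = (3/2 - 1/p)\<^sup>5 (2/p)\<^sup>2\<close>; here \<open>g\<^sub>p \<le> 0.97\<close> gives the decay in \<open>r\<close>, and
  \<open>g\<^sub>p = O(1/p\<^sup>2)\<close> the convergence of the sum.
\<close>

text \<open>On \<open>K\<close> the weight \<open>x ^ k / x powr (\<theta> * r)\<close> is at least
  1, and its mean over the whole law is evaluated by the binomial theorem. Stated for a set
  \<open>K\<close>, the bound serves lower tails (\<open>x < 1\<close>) and upper tails
  (\<open>x > 1\<close>) alike.\<close>

lemma binomial_pmf_markov_power:
  fixes q x \<theta> :: real
  assumes q: "0 \<le> q" "q \<le> 1" and x: "x > 0"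
    and K: "\<And>k. k \<in> K \<Longrightarrow> x powr (\<theta> * real r) \<le> x ^ k"
  shows "measure_pmf.prob (binomial_pmf r q) K \<le> ((1 - q + q * x) / x powr \<theta>) ^ r"
proof -
  have pos: "x powr (\<theta> * real r) > 0" using x by simp
  have "set_pmf (binomial_pmf r q) \<subseteq> {..r}"
    using set_pmf_binomial_eq[of q r] q by (auto split: if_splits)
  then have "measure_pmf.prob (binomial_pmf r q) K \<le> measure_pmf.prob (binomial_pmf r q) (K \<inter> {..r})"
    by (subst measure_Int_set_pmf[symmetric]) (intro measure_pmf.finite_measure_mono, auto)
  also have "\<dots> = (\<Sum>k\<in>K \<inter> {..r}. pmf (binomial_pmf r q) k)"
    by (simp add: measure_measure_pmf_finite)
  also have "\<dots> \<le> (\<Sum>k\<in>K \<inter> {..r}. pmf (binomial_pmf r q) k * (x ^ k / x powr (\<theta> * real r)))"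
  proof (rule sum_mono)
    fix k assume "k \<in> K \<inter> {..r}"
    then have "1 \<le> x ^ k / x powr (\<theta> * real r)" using K pos by simp
    from mult_left_mono[OF this pmf_nonneg]
    show "pmf (binomial_pmf r q) k \<le> pmf (binomial_pmf r q) k * (x ^ k / x powr (\<theta> * real r))"
      by simp
  qed
  also have "\<dots> \<le> (\<Sum>k\<le>r. pmf (binomial_pmf r q) k * (x ^ k / x powr (\<theta> * real r)))"
    using x by (intro sum_mono2) auto
  also have "\<dots> = (\<Sum>k\<le>r. real (r choose k) * (q * x) ^ k * (1 - q) ^ (r - k)) / x powr (\<theta> * real r)"
    unfolding sum_divide_distrib using q
    by (intro sum.cong) (auto simp: power_mult_distrib)
  also have "\<dots> = (q * x + (1 - q)) ^ r / x powr (\<theta> * real r)"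
    by (simp add: binomial_ring)
  also have "\<dots> = ((1 - q + q * x) / x powr \<theta>) ^ r"
    using x by (simp add: power_divide powr_powr[symmetric] powr_realpow add.commute)
  finally show ?thesis .
qed

text \<open>Taking the fifth power of the base clears the exponent 2/5, leaving a rational
  expression in \<open>q\<close> and \<open>x\<close> that can be bounded by arithmetic.\<close>

lemma binomial_pmf_two_fifths_tail:
  fixes q x :: real
  assumes q: "0 \<le> q" "q \<le> 1" and x: "x > 0"
    and K: "\<And>k. k \<in> K \<Longrightarrow> x powr (2 / 5 * real r) \<le> x ^ k"
  shows "measure_pmf.prob (binomial_pmf r q) K \<le> ((1 - q + q * x) ^ 5 / x ^ 2) powr (real r / 5)"
proof -
  define f where "f = (1 - q + q * x) / x powr (2 / 5)"
  have num: "1 - q + q * x > 0"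
    using q x by (cases "q = 1") (auto intro: add_pos_nonneg)
  then have f: "f > 0" using x by (simp add: f_def)
  have "(x powr (2 / 5)) ^ 5 = x powr real 2"
    using powr_realpow[of "x powr (2 / 5)" 5] x by (simp add: powr_powr)
  also have "\<dots> = x ^ 2" using x by (rule powr_realpow)
  finally have "(x powr (2 / 5)) ^ 5 = x ^ 2" .
  then have "(1 - q + q * x) ^ 5 / x ^ 2 = f ^ 5"
    unfolding f_def power_divide by (rule arg_cong[OF sym])
  also have "\<dots> = f powr real 5" using f by (rule powr_realpow[symmetric])
  finally have "((1 - q + q * x) ^ 5 / x ^ 2) powr (real r / 5) = (f powr real 5) powr (real r / 5)"
    by (rule arg_cong)
  also have "\<dots> = f powr real r" unfolding powr_powr by simp
  also have "\<dots> = f ^ r" using f by (rule powr_realpow)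
  finally have "((1 - q + q * x) ^ 5 / x ^ 2) powr (real r / 5) = f ^ r" .
  then show ?thesis
    using binomial_pmf_markov_power[OF q x K] by (simp add: f_def)
qed

lemma binomial_cdf_half_le:
  assumes "t < 2 / 5 * real r"
  shows "binomial_cdf r (1 / 2) t \<le> (97 / 100) powr (real r / 5)"
proof -
  \<comment> \<open>The value \<open>x = 2 / 3\<close> minimises
    \<open>(1 / 2 + x / 2) / x powr (2 / 5)\<close>; the resulting base
    \<open>(5 / 6) ^ 5 / (2 / 3) ^ 2\<close> is about 0.904.\<close>
  have "(2 / 3) powr (2 / 5 * real r) \<le> (2 / 3 :: real) ^ k" if "real k \<le> t" for k
  proof -
    have "(2 / 3 :: real) powr (2 / 5 * real r) \<le> (2 / 3) powr real k"
      using that assms by (intro powr_mono') auto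
    then show ?thesis by (simp add: powr_realpow)
  qed
  then have "binomial_cdf r (1 / 2) t
      \<le> ((1 - 1 / 2 + 1 / 2 * (2 / 3)) ^ 5 / (2 / 3) ^ 2) powr (real r / 5)"
    unfolding binomial_cdf_def by (intro binomial_pmf_two_fifths_tail) auto
  also have "\<dots> \<le> (97 / 100) powr (real r / 5)"
    by (intro powr_mono2) (auto simp: power_divide eval_nat_numeral)
  finally show ?thesis .
qed

text \<open>With \<open>q = 1 / n\<close> and \<open>x = n / 2\<close> the product
  \<open>q * x\<close> is constantly 1/2, so the numerator stays bounded while the denominator grows
  quadratically.\<close>

lemma upper_tail_base_le:
  fixes n :: nat
  assumes "n \<ge> 3"
  defines "g \<equiv> (3 / 2 - 1 / real n) ^ 5 / (real n / 2) ^ 2"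
  shows "0 < g" "g \<le> 31 / real n ^ 2" "g \<le> 97 / 100"
proof -
  have n: "real n \<ge> 3" using assms by simp
  then have h: "0 < 3 / 2 - 1 / real n" by (simp add: field_simps)
  then show "0 < g" using n by (simp add: g_def)
  have "(3 / 2 - 1 / real n) ^ 5 \<le> (3 / 2) ^ 5"
    using h by (intro power_mono) auto
  also have "\<dots> \<le> 31 / 4" by (simp add: eval_nat_numeral)
  finally show le: "g \<le> 31 / real n ^ 2"
    unfolding g_def using n by (simp add: power_divide divide_simps)
  \<comment> \<open>The quadratic bound drops below 1 only from \<open>n = 6\<close> on; smaller
    values are computed. The value at 3, about 0.961, dictates the constant 97/100.\<close>
  consider "n = 3" | "n = 4" | "n = 5" | "n \<ge> 6" using assms by linarith
  then show "g \<le> 97 / 100"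
  proof cases
    case 4
    then have "(6::real) ^ 2 \<le> real n ^ 2" by (intro power_mono) auto
    then have "31 / real n ^ 2 \<le> 31 / 36" using n by (intro divide_left_mono) auto
    with le show ?thesis by linarith
  qed (simp_all add: g_def power_divide eval_nat_numeral)
qed

lemma binomial_cdf_upper_tail_le:
  assumes "n \<ge> 3" and t: "2 / 5 * real r \<le> t" and r: "r \<ge> 5"
  shows "1 - binomial_cdf r (1 / real n) t
    \<le> 31 / real n ^ 2 * (97 / 100) powr (real r / 5 - 1)"
proof -
  define g where "g = (3 / 2 - 1 / real n) ^ 5 / (real n / 2) ^ 2"
  note g = upper_tail_base_le[OF \<open>n \<ge> 3\<close>, folded g_def]
  have n: "real n \<ge> 3" using assms by simp
  have "(real n / 2) powr (2 / 5 * real r) \<le> (real n / 2) ^ k" if "\<not> real k \<le> t" for k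
  proof -
    have "(real n / 2) powr (2 / 5 * real r) \<le> (real n / 2) powr real k"
      using that t n by (intro powr_mono) auto
    then show ?thesis using n by (simp add: powr_realpow)
  qed
  then have "measure_pmf.prob (binomial_pmf r (1 / real n)) (- {k. real k \<le> t})
      \<le> ((1 - 1 / real n + 1 / real n * (real n / 2)) ^ 5 / (real n / 2) ^ 2) powr (real r / 5)"
    using n by (intro binomial_pmf_two_fifths_tail) auto
  also have "1 - 1 / real n + 1 / real n * (real n / 2) = 3 / 2 - 1 / real n"
    using n by (simp add: field_simps)
  \<comment> \<open>One factor \<open>g\<close> is split off to supply the summable
    \<open>31 / n ^ 2\<close>; the remaining power decays in \<open>r\<close> uniformly in
    \<open>n\<close>. Its exponent is nonnegative because \<open>r \<ge> 5\<close>.\<close>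
  also have "((3 / 2 - 1 / real n) ^ 5 / (real n / 2) ^ 2) powr (real r / 5) = g * g powr (real r / 5 - 1)"
    using g(1) by (simp add: g_def[symmetric] powr_diff)
  also have "\<dots> \<le> 31 / real n ^ 2 * (97 / 100) powr (real r / 5 - 1)"
    using g r by (intro mult_mono powr_mono2) auto
  finally show ?thesis
    using measure_pmf.prob_compl[of "{k. real k \<le> t}" "binomial_pmf r (1 / real n)"]
    by (simp add: binomial_cdf_def Compl_eq_Diff_UNIV)
qed

lemma codivisibility_cdf_le: "codivisibility_cdf r t \<le> binomial_cdf r (1 / 2) t"
proof (rule LIMSEQ_le_const2[OF prod_binomial_cdf_tendsto], intro exI allI impI)
  fix n :: nat assume "2 \<le> n"
  then have "(\<Prod>p\<in>{p::nat. prime p \<and> p \<le> n}. binomial_cdf r (1 / real p) t)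
      = binomial_cdf r (1 / real 2) t
        * (\<Prod>p\<in>{p::nat. prime p \<and> p \<le> n} - {2}. binomial_cdf r (1 / real p) t)"
    by (intro prod.remove finite_primes_le) auto
  also have "\<dots> \<le> binomial_cdf r (1 / real 2) t * 1"
    by (intro mult_left_mono prod_le_1) (auto simp: binomial_cdf_nonneg binomial_cdf_le_1)
  finally show "(\<Prod>p\<in>{p::nat. prime p \<and> p \<le> n}. binomial_cdf r (1 / real p) t)
      \<le> binomial_cdf r (1 / 2) t" by simp
qed

lemma codivisibility_cdf_ge_diff:
  assumes t: "2 / 5 * real r \<le> t" and r: "r \<ge> 5"
  shows "binomial_cdf r (1 / 2) t - codivisibility_cdf r t
    \<le> 31 * (\<Sum>n. 1 / real n ^ 2) * (97 / 100) powr (real r / 5 - 1)"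
    (is "?G - _ \<le> ?b")
proof -
  let ?e = "(97 / 100 :: real) powr (real r / 5 - 1)"
  let ?c = "\<lambda>p::nat. binomial_cdf r (1 / real p) t"
  \<comment> \<open>The sum over odd primes will be enlarged to all naturals; the term at 0 vanishes
    because \<open>1 / 0 = 0\<close>.\<close>
  have summ: "summable (\<lambda>n. 1 / real n ^ 2)"
    using inverse_power_summable[of 2, where ?'a = real] by (simp add: inverse_eq_divide)
  have "?G - ?b \<le> codivisibility_cdf r t"
  proof (rule LIMSEQ_le_const[OF prod_binomial_cdf_tendsto], intro exI allI impI)
    fix n :: nat assume n: "2 \<le> n"
    define P where "P = {p::nat. prime p \<and> p \<le> n} - {2}"
    have fin: "finite P" by (simp add: P_def finite_primes_le)
    have P3: "p \<ge> 3" if "p \<in> P" for p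
      using that prime_ge_2_nat[of p] by (auto simp: P_def)
    have "(\<Sum>p\<in>P. 1 - ?c p) \<le> (\<Sum>p\<in>P. 31 / real p ^ 2 * ?e)"
      by (intro sum_mono binomial_cdf_upper_tail_le P3 t r)
    also have "\<dots> = 31 * ?e * (\<Sum>p\<in>P. 1 / real p ^ 2)"
      by (subst sum_distrib_left) (intro sum.cong, auto)
    also have "\<dots> \<le> 31 * ?e * (\<Sum>n. 1 / real n ^ 2)"
      by (intro mult_left_mono sum_le_suminf summ fin) auto
    finally have S: "(\<Sum>p\<in>P. 1 - ?c p) \<le> ?b" by (simp add: mult_ac)
    have b: "0 \<le> ?b" by (intro mult_nonneg_nonneg suminf_nonneg summ) auto
    have "?G - ?b \<le> ?G - ?G * ?b"
      using b mult_right_mono[OF binomial_cdf_le_1[of r "1/2" t] b] by simp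
    also have "\<dots> \<le> ?G * (1 - (\<Sum>p\<in>P. 1 - ?c p))"
      using mult_left_mono[OF S binomial_cdf_nonneg[of r "1/2" t]] by (simp add: right_diff_distrib)
    \<comment> \<open>Weierstrass: a product of factors \<open>1 - a\<close> with \<open>a\<close>
      in [0, 1] is at least 1 minus the sum of the \<open>a\<close>.\<close>
    also have "\<dots> \<le> ?G * (\<Prod>p\<in>P. 1 - (1 - ?c p))"
      by (intro mult_left_mono Weierstrass_prod_ineq binomial_cdf_nonneg)
        (auto simp: binomial_cdf_nonneg binomial_cdf_le_1)
    also have "\<dots> = ?c 2 * (\<Prod>p\<in>P. ?c p)" by simp
    also have "\<dots> = (\<Prod>p\<in>{p::nat. prime p \<and> p \<le> n}. ?c p)"
      unfolding P_def using n by (intro prod.remove[symmetric] finite_primes_le) auto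
    finally show "?G - ?b \<le> (\<Prod>p\<in>{p::nat. prime p \<and> p \<le> n}. ?c p)" .
  qed
  then show ?thesis by simp
qed

theorem theorem1:
  shows "\<exists>A>0. \<exists>B>0. \<forall>r::nat. r \<ge> 2 \<longrightarrow>
    (\<forall>\<mu>. codivisibility_law r \<mu> \<longrightarrow>
      (\<forall>t::real. 0 \<le> binomial_cdf r (1 / 2) t - cdf \<mu> t \<and>
        binomial_cdf r (1 / 2) t - cdf \<mu> t \<le> A * exp (- B * real r)))"
proof -
  define S where "S = (\<Sum>n. 1 / real n ^ 2)"
  \<comment> \<open>The summand 1 serves small \<open>r\<close> and small \<open>t\<close>,
    \<open>31 * S\<close> serves large \<open>t\<close>, and \<open>100 / 97\<close> absorbs the
    shift by -1 in the exponent of \<open>?e\<close>.\<close>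
  define A where "A = (1 + 31 * S) * (100 / 97)"
  define B where "B = - ln (97 / 100 :: real) / 5"
  have S: "S \<ge> 0"
    using inverse_power_summable[of 2, where ?'a = real]
    unfolding S_def by (intro suminf_nonneg) (auto simp: inverse_eq_divide)
  have A: "A > 0" using S by (simp add: A_def)
  have B: "B > 0" by (simp add: B_def)
  have "binomial_cdf r (1 / 2) t - codivisibility_cdf r t \<le> A * exp (- B * real r)" for r t
  proof -
    let ?d = "binomial_cdf r (1 / 2) t - codivisibility_cdf r t"
    let ?e = "(97 / 100 :: real) powr (real r / 5 - 1)"
    have "exp (- B * real r) = 97 / 100 * ?e"
      unfolding powr_diff by (simp add: B_def powr_def mult.commute)
    then have Ae: "A * exp (- B * real r) = ?e + 31 * S * ?e"
      by (simp add: A_def algebra_simps)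
    have nn: "0 \<le> ?e" "0 \<le> 31 * S * ?e" using S by auto
    have F: "0 \<le> codivisibility_cdf r t"
      by (rule LIMSEQ_le_const[OF prod_binomial_cdf_tendsto])
        (auto intro!: prod_nonneg binomial_cdf_nonneg)
    consider "r < 5" | "r \<ge> 5" "t < 2 / 5 * real r" | "r \<ge> 5" "2 / 5 * real r \<le> t" by linarith
    then have "?d \<le> ?e + 31 * S * ?e"
    proof cases
      case 1
      \<comment> \<open>For \<open>r < 5\<close> the exponent of \<open>?e\<close> is negative, so
        \<open>?e\<close> exceeds 1 and the trivial bound 1 on the difference suffices.\<close>
      then have "(97 / 100 :: real) powr 0 \<le> ?e" by (intro powr_mono') auto
      then show ?thesis using F binomial_cdf_le_1[of r "1/2" t] nn by simp
    next
      case 2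
      have "(97 / 100 :: real) powr (real r / 5) \<le> ?e" by (intro powr_mono') auto
      with binomial_cdf_half_le[OF 2(2)] F nn show ?thesis by linarith
    next
      case 3
      with codivisibility_cdf_ge_diff[OF 3(2,1), folded S_def] nn show ?thesis by linarith
    qed
    with Ae show ?thesis by simp
  qed
  with A B show ?thesis
    using codivisibility_cdf_le
    by (intro exI[of _ A] conjI exI[of _ B]) (auto simp: codivisibility_law_def)
qed

end
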